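(* Let $A$ be a positive integer with $A\equiv \pm 3\pmod{24}$. If there exists a prime $p\equiv 2\pmod 3$ such that $v_p(A^2-9)$ is odd, then there does not exist a $\left(\tfrac14(A^2+3),\ \tfrac18(A-1)(A-3),\ \tfrac1{16}(A-3)(A-5)\right)$ cyclic difference set. Equivalently, there is no binary sequence $\mathbf a$ of period $n=\tfrac14(A^2+3)$ with $C_{\mathbf a}(t)=3$ for all $1\le t\le n-1$.
   Context: For a prime $p$ and a nonzero integer $m$, $v_p(m)$ is the exponent of the highest power of $p$ dividing $m$ ($v_p(0)=\infty$). An $(n,k,\lambda)$ cyclic difference set is a $k$-subset $D$ of a cyclic group $G$ of order $n$ such that every non-identity $g\in G$ has exactly $\lambda$ representations $g=xy^{-1}$, $x,y\in D$. A binary sequence of period $n$ is $\mathbf a=(a_0,a_1,\ldots)$ with $a_j\in\{-1,1\}$, $a_{j+n}=a_j$; $C_{\mathbf a}(t)=\sum_{i=0}^{n-1}a_ia_{i+t}$. *)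

theory Defs
  imports Complex_Main "HOL-Algebra.Elementary_Groups" "HOL-Number_Theory.Cong"
begin

(* order G = card (carrier G) is 0 for an infinite group, hence the explicit finiteness. *)
definition cyclic_difference_set ::
  "('g, 'm) monoid_scheme \<Rightarrow> nat \<Rightarrow> nat \<Rightarrow> nat \<Rightarrow> 'g set \<Rightarrow> bool" where
  "cyclic_difference_set G n k l D \<longleftrightarrow>
     group G \<and> cyclic_group G \<and> finite (carrier G) \<and> order G = n \<and>
     D \<subseteq> carrier G \<and> card D = k \<and>
     (\<forall>g \<in> carrier G - {\<one>\<^bsub>G\<^esub>}.
        card {(x, y). x \<in> D \<and> y \<in> D \<and> g = x \<otimes>\<^bsub>G\<^esub> inv\<^bsub>G\<^esub> y} = l)"

(* n is a period, not necessarily the least one. *)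
definition binary_sequence :: "nat \<Rightarrow> (nat \<Rightarrow> int) \<Rightarrow> bool" where
  "binary_sequence n a \<longleftrightarrow> 0 < n \<and> (\<forall>j. a j \<in> {-1, 1}) \<and> (\<forall>j. a (j + n) = a j)"

definition autocorrelation :: "nat \<Rightarrow> (nat \<Rightarrow> int) \<Rightarrow> nat \<Rightarrow> int" where
  "autocorrelation n a t = (\<Sum>i<n. a i * a (i + t))"

end

theory Submission
  imports Defs "HOL-Algebra.Multiplicative_Group" "HOL-Number_Theory.Residues"
begin

text \<open>
  Since 3 divides \<open>n\<close>, the sequence, or the indicator function of the difference set, can be folded
  modulo 3. The folded function still has one value of the autocorrelation at 0 and another
  elsewhere, with the same difference of the two, and for a function on the integers modulo 3 this
  difference is a norm \<open>x\<^sup>2 + x * y + y\<^sup>2\<close> from the Eisenstein integers. Here it is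
  \<open>(A\<^sup>2 - 9) / 16\<close> for difference sets and \<open>(A\<^sup>2 - 9) / 4\<close> for sequences, so \<open>A\<^sup>2 - 9\<close> is such a
  norm. A prime congruent to 2 modulo 3 is inert in the Eisenstein integers, so its multiplicity in
  any nonzero norm is even.
\<close>

text \<open>If \<open>p\<close> divided the norm but not \<open>x\<close>, it would not divide
  \<open>y\<close> either. The norm divides \<open>x ^ 3 - y ^ 3\<close>, and cubing is injective on
  the units modulo \<open>p\<close> because \<open>p - 1\<close> is coprime to 3. So
  \<open>x\<close> and \<open>y\<close> would be congruent, which turns the norm into
  \<open>3 * y\<^sup>2\<close> and leaves only \<open>p = 3\<close>.\<close>

lemma prime_dvd_eisenstein_norm:
  fixes x y :: int and p :: nat
  assumes p: "prime p" "[p = 2] (mod 3)" and dvd: "int p dvd x\<^sup>2 + x * y + y\<^sup>2"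
  shows "int p dvd x \<and> int p dvd y"
proof -
  have pi: "prime (int p)" using p by simp
  have main: "int p dvd x" if dvd: "int p dvd x\<^sup>2 + x * y + y\<^sup>2" for x y :: int
  proof (rule ccontr)
    assume nx: "\<not> int p dvd x"
    have ny: "\<not> int p dvd y"
    proof
      assume "int p dvd y"
      then have "int p dvd (x\<^sup>2 + x * y + y\<^sup>2) - y * (x + y)"
        using dvd by (meson dvd_diff dvd_mult2)
      then have "int p dvd x\<^sup>2" by (simp add: algebra_simps power2_eq_square)
      with nx show False using pi prime_dvd_power by blast
    qed
    have "p mod 3 = 2" using p(2) by (simp add: cong_def)
    then obtain q where q: "p = 3 * q + 2" by (metis mult_div_mod_eq)
    \<comment> \<open>The exponent is \<open>p - 1\<close>. As \<open>fermat_theorem\<close>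
      concerns natural numbers, \<open>z\<close> is replaced by its least nonnegative
      residue.\<close>
    have fermat: "[z ^ (3 * q + 1) = 1] (mod int p)" if "\<not> int p dvd z" for z :: int
    proof -
      have z: "[int (nat (z mod int p)) = z] (mod int p)"
        using q by (simp add: cong_def)
      then have "\<not> p dvd nat (z mod int p)"
        using that cong_dvd_iff int_dvd_int_iff by blast
      then have "[nat (z mod int p) ^ (3 * q + 1) = 1] (mod p)"
        using fermat_theorem[OF p(1)] q by simp
      then have "[int (nat (z mod int p)) ^ (3 * q + 1) = 1] (mod int p)"
        by (metis cong_int_iff of_nat_1 of_nat_power)
      with z show ?thesis by (meson cong_pow cong_sym cong_trans)
    qed
    have "(x ^ 3 - y ^ 3) = (x - y) * (x\<^sup>2 + x * y + y\<^sup>2)"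
      by (simp add: algebra_simps power2_eq_square power3_eq_cube)
    then have "[x ^ 3 = y ^ 3] (mod int p)"
      using dvd by (simp add: cong_iff_dvd_diff)
    \<comment> \<open>Equal cubes make the powers with exponent \<open>3 * q\<close> equal. By
      Fermat one further factor \<open>x\<close> or \<open>y\<close> makes both products 1, so these
      factors agree too.\<close>
    then have "[(x ^ 3) ^ q * x = (y ^ 3) ^ q * x] (mod int p)"
      by (rule cong_mult[OF cong_pow cong_refl])
    moreover have "[(x ^ 3) ^ q * x = (y ^ 3) ^ q * y] (mod int p)"
      using fermat[OF nx] fermat[OF ny]
      by (metis power_mult power_add power_one_right cong_sym cong_trans)
    ultimately have "[(y ^ 3) ^ q * x = (y ^ 3) ^ q * y] (mod int p)"
      using cong_sym cong_trans by blast
    then have "int p dvd (y ^ 3) ^ q * (x - y)"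
      by (simp add: cong_iff_dvd_diff right_diff_distrib)
    then have "int p dvd x - y"
      using pi ny by (meson prime_dvd_mult_iff prime_dvd_power)
    then have "int p dvd (x\<^sup>2 + x * y + y\<^sup>2) - (x - y) * (x + 2 * y)"
      using dvd by (meson dvd_diff dvd_mult2)
    then have "int p dvd 3 * y\<^sup>2" by (simp add: algebra_simps power2_eq_square)
    then have "int p dvd 3" using pi ny by (meson prime_dvd_mult_iff prime_dvd_power)
    then have "p dvd 3" by (metis int_dvd_int_iff of_nat_numeral)
    then have "p \<le> 3" by (simp add: dvd_imp_le)
    then have "p = 2" using q by simp
    with \<open>p dvd 3\<close> show False by simp
  qed
  have "int p dvd y\<^sup>2 + y * x + x\<^sup>2" using dvd by (simp add: algebra_simps)
  with main dvd show ?thesis by blast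
qed

text \<open>Descent: if \<open>p\<close> divides the norm, it divides both coordinates, and dividing
  them by \<open>p\<close> lowers the multiplicity by exactly 2.\<close>

lemma even_multiplicity_eisenstein_norm:
  fixes x y :: int and p :: nat
  assumes p: "prime p" "[p = 2] (mod 3)" and nz: "x\<^sup>2 + x * y + y\<^sup>2 \<noteq> 0"
  shows "even (multiplicity (int p) (x\<^sup>2 + x * y + y\<^sup>2))"
  using nz
proof (induction "multiplicity (int p) (x\<^sup>2 + x * y + y\<^sup>2)" arbitrary: x y rule: less_induct)
  case less
  let ?N = "x\<^sup>2 + x * y + y\<^sup>2"
  have p0: "int p \<noteq> 0" "\<not> is_unit (int p)" using p prime_gt_1_nat[of p] by auto
  show ?case
  proof (cases "int p dvd ?N")
    case False
    then show ?thesis by (simp add: not_dvd_imp_multiplicity_0)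
  next
    case True
    then obtain u v where uv: "x = int p * u" "y = int p * v"
      using prime_dvd_eisenstein_norm[OF p] by (meson dvdE)
    have N: "?N = int p * (int p * (u\<^sup>2 + u * v + v\<^sup>2))"
      by (simp add: uv algebra_simps power2_eq_square)
    have nz: "u\<^sup>2 + u * v + v\<^sup>2 \<noteq> 0" using less.prems N by auto
    have m: "multiplicity (int p) ?N = Suc (Suc (multiplicity (int p) (u\<^sup>2 + u * v + v\<^sup>2)))"
      unfolding N using nz p0 by (simp add: multiplicity_times_same)
    show ?thesis using less.hyps[OF _ nz] m by simp
  qed
qed

lemma sum_residue_classes:
  fixes f :: "nat \<Rightarrow> 'a :: comm_monoid_add"
  shows "(\<Sum>i<d * m. f i) = (\<Sum>q<d. \<Sum>j<m. f (q + d * j))"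
proof -
  have "(\<Sum>i<d * m. f i) = (\<Sum>j<m. \<Sum>i\<in>{j * d..<j * d + d}. f i)"
    by (simp add: sum.nat_group mult.commute)
  also have "\<dots> = (\<Sum>j<m. \<Sum>q<d. f (q + d * j))"
  proof (rule sum.cong[OF refl])
    fix j
    show "(\<Sum>i\<in>{j * d..<j * d + d}. f i) = (\<Sum>q<d. f (q + d * j))"
      using sum.shift_bounds_nat_ivl[of f 0 "j * d" d]
      by (simp add: atLeast0LessThan add.commute mult.commute)
  qed
  also have "\<dots> = (\<Sum>q<d. \<Sum>j<m. f (q + d * j))" by (rule sum.swap)
  finally show ?thesis .
qed

text \<open>Summing over residue classes is the push-forward from the integers modulo
  \<open>d * m\<close> to those modulo \<open>d\<close>. It respects correlation, so the folded
  autocorrelation at \<open>r\<close> collects the original values at all shifts congruent to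
  \<open>r\<close>.\<close>

lemma autocorrelation_fold:
  fixes f :: "nat \<Rightarrow> int" and d m :: nat
  assumes per: "\<And>i. f (i + d * m) = f i"
  defines "S \<equiv> \<lambda>r. \<Sum>j<m. f (r + d * j)"
  shows "(\<Sum>s<m. autocorrelation (d * m) f (r + d * s)) = autocorrelation d S r"
    and "S (r + d) = S r"
proof -
  have step: "S (r + d) = S r" for r
  proof -
    have "S (r + d) = (\<Sum>j<m. f (r + d * Suc j))"
      by (simp add: S_def algebra_simps)
    \<comment> \<open>Moving the window by \<open>d\<close> trades the term \<open>f r\<close> for
      \<open>f (r + d * m)\<close>, which is equal by periodicity.\<close>
    moreover have "f r + (\<Sum>j<m. f (r + d * Suc j)) = S r + f (r + d * m)"
      unfolding S_def
      using sum.lessThan_Suc_shift[of "\<lambda>j. f (r + d * j)" m] sum.lessThan_Suc[of "\<lambda>j. f (r + d * j)" m]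
      by simp
    ultimately show ?thesis using per[of r] by simp
  qed
  then show "S (r + d) = S r" .
  have steps: "S (r + d * j) = S r" for r j
    by (induction j) (simp_all, metis step add.assoc add.commute)
  \<comment> \<open>For fixed \<open>i\<close>, the sum over \<open>s\<close> of the shifted factors
    is \<open>S (i + r)\<close>.\<close>
  have "(\<Sum>s<m. autocorrelation (d * m) f (r + d * s)) = (\<Sum>i<d * m. f i * S (i + r))"
    unfolding autocorrelation_def
    by (subst sum.swap) (simp add: S_def sum_distrib_left add.assoc)
  also have "\<dots> = (\<Sum>q<d. \<Sum>j<m. f (q + d * j) * S (q + r + d * j))"
    by (subst sum_residue_classes) (simp add: algebra_simps)
  also have "\<dots> = autocorrelation d S r"
    unfolding autocorrelation_def by (simp only: steps) (simp add: S_def sum_distrib_right)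
  finally show "(\<Sum>s<m. autocorrelation (d * m) f (r + d * s)) = autocorrelation d S r" .
qed

text \<open>Fold with \<open>d = 3\<close>. The shifts divisible by 3 contribute the value at 0 and
  \<open>m - 1\<close> copies of \<open>c\<close>, those congruent to 1 contribute \<open>m\<close>
  copies, so the gap survives the folding.\<close>

lemma autocorrelation_gap_eisenstein_norm:
  fixes f :: "nat \<Rightarrow> int" and n :: nat
  assumes n: "3 dvd n" "0 < n" and per: "\<And>i. f (i + n) = f i"
    and corr: "\<And>t. 1 \<le> t \<Longrightarrow> t \<le> n - 1 \<Longrightarrow> autocorrelation n f t = c"
  obtains x y where "autocorrelation n f 0 - c = x\<^sup>2 + x * y + y\<^sup>2"
proof -
  obtain m where m: "n = 3 * m" using n by blast
  then obtain m' where m': "m = Suc m'" using n by (cases m) auto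
  define S where "S = (\<lambda>r. \<Sum>j<m. f (r + 3 * j))"
  have fold: "(\<Sum>s<m. autocorrelation n f (r + 3 * s)) = autocorrelation 3 S r" for r
    using autocorrelation_fold(1)[of f 3 m r] per by (simp add: m S_def)
  have S3: "S (Suc (Suc (Suc 0))) = S 0"
    using autocorrelation_fold(2)[of f 3 m 0] per by (simp add: m S_def numeral_3_eq_3)
  have "(\<Sum>s<m. autocorrelation n f (0 + 3 * s)) = autocorrelation n f 0 + (\<Sum>s<m'. c)"
    unfolding m' sum.lessThan_Suc_shift
    by (intro arg_cong2[where f = "(+)"] sum.cong refl corr) (auto simp: m m')
  moreover have "(\<Sum>s<m. autocorrelation n f (1 + 3 * s)) = (\<Sum>s<m. c)"
    by (intro sum.cong refl corr) (auto simp: m)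
  ultimately have "autocorrelation n f 0 - c = autocorrelation 3 S 0 - autocorrelation 3 S 1"
    using fold[of 0] fold[of 1] by (simp add: m' algebra_simps)
  \<comment> \<open>For period 3 the gap is the sum of the three squares minus the sum of the three
    mixed products: the norm of \<open>S 0 + S 1 * w + S 2 * w\<^sup>2\<close> for a primitive cube
    root of unity \<open>w\<close>.\<close>
  also have "\<dots> = (S 0 - S 1)\<^sup>2 + (S 0 - S 1) * (S 1 - S 2) + (S 1 - S 2)\<^sup>2"
    by (simp add: autocorrelation_def numeral_3_eq_3 numeral_2_eq_2 S3 algebra_simps power2_eq_square)
  finally show ?thesis using that by blast
qed

text \<open>The function is the indicator of \<open>D\<close> along the powers of a generator
  \<open>g\<close>. Its autocorrelation at \<open>t\<close> counts the \<open>y\<close> in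
  \<open>D\<close> with \<open>g [^] t \<otimes> y\<close> in \<open>D\<close>, that is, the
  representations of \<open>g [^] t\<close> as a quotient.\<close>

lemma cyclic_difference_set_indicator:
  fixes G (structure)
  assumes "cyclic_difference_set G n k l D"
  obtains f :: "nat \<Rightarrow> int" where "0 < n" "\<And>i. f (i + n) = f i" "autocorrelation n f 0 = int k"
    "\<And>t. 1 \<le> t \<Longrightarrow> t \<le> n - 1 \<Longrightarrow> autocorrelation n f t = int l"
proof -
  have G: "group G" "cyclic_group G" and fin: "finite (carrier G)" and ord: "order G = n"
    and D: "D \<subseteq> carrier G" "card D = k"
    and diff: "\<And>g. g \<in> carrier G - {\<one>\<^bsub>G\<^esub>} \<Longrightarrow>
        card {(x, y). x \<in> D \<and> y \<in> D \<and> g = x \<otimes>\<^bsub>G\<^esub> inv\<^bsub>G\<^esub> y} = l"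
    using assms by (auto simp: cyclic_difference_set_def)
  interpret group G by fact
  obtain g where g: "g \<in> carrier G" "subgroup_generated G {g} = G"
    using G by (auto simp: cyclic_group_def)
  have og: "ord g = n" using cyclic_order_is_ord[OF g(1)] g ord by simp
  have n0: "0 < n" using ord fin order_gt_0_iff_finite by simp
  have inj: "inj_on (\<lambda>i. g [^] i) {..<n}"
    using ord_inj[OF g(1)] by (rule inj_on_subset) (use og in auto)
  have surj: "(\<lambda>i. g [^] i) ` {..<n} = carrier G"
  proof (rule card_subset_eq[OF fin])
    show "(\<lambda>i. g [^] i) ` {..<n} \<subseteq> carrier G" using g by auto
    show "card ((\<lambda>i. g [^] i) ` {..<n}) = card (carrier G)"
      using card_image[OF inj] ord by (simp add: order_def)
  qed
  define f :: "nat \<Rightarrow> int" where "f = (\<lambda>i. of_bool (g [^] i \<in> D))"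
  have "autocorrelation n f t = int (card {i\<in>{..<n}. g [^] i \<in> D \<and> g [^] (i + t) \<in> D})" for t
    unfolding autocorrelation_def f_def of_bool_conj[symmetric]
    by (subst sum_of_bool_eq) (simp_all add: Int_def)
  moreover have "card {i\<in>{..<n}. g [^] i \<in> D \<and> g [^] (i + t) \<in> D} =
      card {y \<in> D. g [^] t \<otimes> y \<in> D}" for t
  proof (rule bij_betw_same_card[of "\<lambda>i. g [^] i"], unfold bij_betw_def, intro conjI)
    let ?I = "{i\<in>{..<n}. g [^] i \<in> D \<and> g [^] (i + t) \<in> D}"
    have add: "g [^] (i + t) = g [^] t \<otimes> g [^] i" for i
      using g by (simp add: nat_pow_mult add.commute)
    show "inj_on (\<lambda>i. g [^] i) ?I" using inj by (rule inj_on_subset) auto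
    show "(\<lambda>i. g [^] i) ` ?I = {y \<in> D. g [^] t \<otimes> y \<in> D}"
    proof
      show "(\<lambda>i. g [^] i) ` ?I \<subseteq> {y \<in> D. g [^] t \<otimes> y \<in> D}" by (auto simp: add)
      show "{y \<in> D. g [^] t \<otimes> y \<in> D} \<subseteq> (\<lambda>i. g [^] i) ` ?I"
      proof
        fix y assume y: "y \<in> {y \<in> D. g [^] t \<otimes> y \<in> D}"
        then obtain i where "i < n" "y = g [^] i" using surj D by blast
        with y show "y \<in> (\<lambda>i. g [^] i) ` ?I" by (auto simp: add)
      qed
    qed
  qed
  ultimately have corr: "autocorrelation n f t = int (card {y \<in> D. g [^] t \<otimes> y \<in> D})" for t
    by simp
  show ?thesis
  proof (rule that)
    show "0 < n" by fact
    show "f (i + n) = f i" for i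
      using g og pow_ord_eq_1[OF g(1)] by (simp add: f_def flip: nat_pow_mult)
    have "{y \<in> D. g [^] (0::nat) \<otimes> y \<in> D} = D" using D by auto
    then show "autocorrelation n f 0 = int k" using corr[of 0] D by simp
    show "autocorrelation n f t = int l" if t: "1 \<le> t" "t \<le> n - 1" for t
    proof -
      \<comment> \<open>The order of \<open>g\<close> is \<open>n\<close>, and no \<open>t\<close>
        in this range is a multiple of it.\<close>
      have "g [^] t \<noteq> \<one>" using pow_eq_id[OF g(1), of t] og t n0 by (auto dest: dvd_imp_le)
      moreover have "card {y \<in> D. g [^] t \<otimes> y \<in> D} =
          card {(x, y). x \<in> D \<and> y \<in> D \<and> g [^] t = x \<otimes> inv y}"
      proof (rule bij_betw_same_card[of "\<lambda>y. (g [^] t \<otimes> y, y)"], unfold bij_betw_def, intro conjI)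
        show "inj_on (\<lambda>y. (g [^] t \<otimes> y, y)) {y \<in> D. g [^] t \<otimes> y \<in> D}"
          by (auto simp: inj_on_def)
        have "g [^] t \<otimes> y = x \<longleftrightarrow> g [^] t = x \<otimes> inv y" if "x \<in> D" "y \<in> D" for x y
          using that D g inv_solve_right[of "g [^] t" x y] by (auto simp: subset_iff)
        then show "(\<lambda>y. (g [^] t \<otimes> y, y)) ` {y \<in> D. g [^] t \<otimes> y \<in> D} =
            {(x, y). x \<in> D \<and> y \<in> D \<and> g [^] t = x \<otimes> inv y}"
          by (auto simp: image_iff)
      qed
      ultimately show ?thesis using diff[of "g [^] t"] corr[of t] g by simp
    qed
  qed
qed

theorem theorem4p1:
  fixes A :: int and n k l :: nat
  assumes "0 < A"
    and "[A = 3] (mod 24) \<or> [A = -3] (mod 24)"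
    and "\<exists>p::nat. prime p \<and> [p = 2] (mod 3) \<and>
           A^2 - 9 \<noteq> 0 \<and> odd (multiplicity (int p) (A^2 - 9))"
    and "real n = (real_of_int A ^ 2 + 3) / 4"
    and "real k = (real_of_int A - 1) * (real_of_int A - 3) / 8"
    and "real l = (real_of_int A - 3) * (real_of_int A - 5) / 16"
  shows "(\<nexists>(G :: ('g, 'm) monoid_scheme) D. cyclic_difference_set G n k l D) \<and>
         (\<nexists>a. binary_sequence n a \<and>
              (\<forall>t. 1 \<le> t \<and> t \<le> n - 1 \<longrightarrow> autocorrelation n a t = 3))"
proof -
  have no_norm: False if "A\<^sup>2 - 9 = x\<^sup>2 + x * y + y\<^sup>2" for x y
    using assms(3) even_multiplicity_eisenstein_norm that by metis
  have "real_of_int (4 * int n) = real_of_int (A\<^sup>2 + 3)" using assms(4) by simp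
  then have n: "4 * int n = A\<^sup>2 + 3" by linarith
  \<comment> \<open>The factor \<open>A - 3\<close> is common:
    \<open>2 * (A - 1) - (A - 5) = A + 3\<close>.\<close>
  have "real_of_int (16 * (int k - int l)) = real_of_int (A\<^sup>2 - 9)"
    using assms(5,6) by (simp add: field_simps power2_eq_square)
  then have kl: "16 * (int k - int l) = A\<^sup>2 - 9" by linarith
  have "A mod 24 = 3 \<or> A mod 24 = 21" using assms(2) by (simp add: cong_def)
  then have "3 dvd A" by presburger
  then have "3 dvd 4 * int n" unfolding n by (simp add: power2_eq_square)
  then have n3: "3 dvd n" by presburger
  have "\<not> cyclic_difference_set G n k l D" for G :: "('g, 'm) monoid_scheme" and D
  proof
    assume "cyclic_difference_set G n k l D"
    then obtain f :: "nat \<Rightarrow> int" where f: "0 < n" "\<And>i. f (i + n) = f i"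
      "autocorrelation n f 0 = int k"
      "\<And>t. 1 \<le> t \<Longrightarrow> t \<le> n - 1 \<Longrightarrow> autocorrelation n f t = int l"
      using cyclic_difference_set_indicator by blast
    obtain x y where "int k - int l = x\<^sup>2 + x * y + y\<^sup>2"
      using autocorrelation_gap_eisenstein_norm[OF n3 f(1,2,4)] f(3) by metis
    \<comment> \<open>The factor 16 is a square, so it is absorbed by scaling both
      coordinates.\<close>
    then have "A\<^sup>2 - 9 = (4 * x)\<^sup>2 + (4 * x) * (4 * y) + (4 * y)\<^sup>2"
      using kl by (simp add: power2_eq_square)
    then show False by (rule no_norm)
  qed
  moreover have False if a: "binary_sequence n a"
    and c: "\<forall>t. 1 \<le> t \<and> t \<le> n - 1 \<longrightarrow> autocorrelation n a t = 3" for a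
  proof -
    have sq: "a i * a i = 1" for i
      using a by (auto simp: binary_sequence_def dest: spec[of _ i])
    obtain x y where "autocorrelation n a 0 - 3 = x\<^sup>2 + x * y + y\<^sup>2"
      using autocorrelation_gap_eisenstein_norm[OF n3, of a 3] a c
      by (auto simp: binary_sequence_def)
    \<comment> \<open>The value at shift 0 is \<open>n\<close>, since all entries square to 1, and
      \<open>4 * (n - 3) = A\<^sup>2 - 9\<close>; the factor 4 is again a square.\<close>
    then have "A\<^sup>2 - 9 = (2 * x)\<^sup>2 + (2 * x) * (2 * y) + (2 * y)\<^sup>2"
      using n by (simp add: autocorrelation_def sq power2_eq_square)
    then show False by (rule no_norm)
  qed
  ultimately show ?thesis by blast
qed

end
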